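(* Let $(X,<)$ be a strict poset and let $A\subseteq X$. Let $X/A$ be the quotient of $X$ by the equivalence relation $\mathscr{R}_A=\{(x,x)\mid x\in X\}\cup(A\times A)$, with quotient map $q_A:X\to X/A$, and let $<'$ be the relation on $X/A$ induced by $<$. Then $q_A:(X,<)\to(X/A,<')$ is order preserving (that is, $<'$ is a strict partial order on $X/A$ and $x<y$ implies $q_A(x)<'q_A(y)$ for all $x,y\in X$) if and only if $A$ is an antichain in $(X,<)$.
   Context: A strict partial order is an irreflexive and transitive relation; a strict poset is a set with a strict partial order. An antichain is a subset no two elements of which are comparable (i.e. there are no $a,b\in A$ with $a<b$). For an equivalence relation $\mathscr{R}$ on $X$, the relation $<'$ on $X/\mathscr{R}$ induced by $<$ is the transitive closure of the relation $S_0$ given by $([a],[b])\in S_0 \iff \exists x\in[a],\,y\in[b]$ with $x<y$. *)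

theory Defs
  imports Main
begin

definition strict_poset :: "'a set \<Rightarrow> 'a rel \<Rightarrow> bool" where
  "strict_poset X r \<longleftrightarrow> r \<subseteq> X \<times> X \<and> irrefl_on X r \<and> trans r"

definition antichain_in :: "'a set \<Rightarrow> 'a rel \<Rightarrow> 'a set \<Rightarrow> bool" where
  "antichain_in X r A \<longleftrightarrow> A \<subseteq> X \<and> \<not> (\<exists>a\<in>A. \<exists>b\<in>A. (a, b) \<in> r)"

definition order_preserving ::
    "'a set \<Rightarrow> 'a rel \<Rightarrow> 'b set \<Rightarrow> 'b rel \<Rightarrow> ('a \<Rightarrow> 'b) \<Rightarrow> bool" where
  "order_preserving X r Y s f \<longleftrightarrow>
     strict_poset X r \<and> strict_poset Y s \<and> f ` X \<subseteq> Y \<and>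
     (\<forall>x\<in>X. \<forall>y\<in>X. (x, y) \<in> r \<longrightarrow> (f x, f y) \<in> s)"

definition induced_rel :: "'a set \<Rightarrow> 'a rel \<Rightarrow> 'a rel \<Rightarrow> 'a set rel" where
  "induced_rel X R r =
     {(P, Q). P \<in> X // R \<and> Q \<in> X // R \<and> (\<exists>x\<in>P. \<exists>y\<in>Q. (x, y) \<in> r)}\<^sup>+"

definition collapse_rel :: "'a set \<Rightarrow> 'a set \<Rightarrow> 'a rel" where
  "collapse_rel X A = Id_on X \<union> A \<times> A"

lemma equiv_collapse_rel: "A \<subseteq> X \<Longrightarrow> equiv X (collapse_rel X A)"
  by (rule equivI) (auto simp: collapse_rel_def refl_on_def sym_def trans_def)

end

theory Submission
  imports Defs
begin

text \<open>
  If \<^term>\<open>A\<close> is an antichain, a chain of the relation whose transitive closure is taken either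
  lifts to a single comparison in \<^term>\<open>X\<close> or splits at the class \<^term>\<open>A\<close> into a comparison
  ending in \<^term>\<open>A\<close> and one starting in \<^term>\<open>A\<close>. A closed chain would then yield two
  comparable elements of \<^term>\<open>A\<close> or a reflexive pair.
\<close>

lemma collapse_rel_Image:
  assumes "A \<subseteq> X" "x \<in> X"
  shows "collapse_rel X A `` {x} = (if x \<in> A then A else {x})"
  using assms by (auto simp: collapse_rel_def)

lemma quotient_collapse_rel_cases:
  assumes "A \<subseteq> X" "P \<in> X // collapse_rel X A"
  obtains "P = A" | x where "x \<in> X" "x \<notin> A" "P = {x}"
proof -
  obtain x where "x \<in> X" "P = collapse_rel X A `` {x}"
    using assms(2) by (rule quotientE)
  with assms(1) show thesis
    using that by (metis collapse_rel_Image)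
qed

lemma induced_rel_subset: "induced_rel X R r \<subseteq> (X // R) \<times> (X // R)"
  unfolding induced_rel_def by (rule trancl_subset_Sigma) auto

text \<open>Induction along the chain. Consecutive comparisons meeting in a singleton class share
  their point and compose by transitivity; those meeting in \<open>A\<close> may use different
  points, so only the comparison into \<open>A\<close> and the one out of it are kept.\<close>

lemma induced_rel_collapse_lift:
  assumes "trans r" "A \<subseteq> X" "(P, Q) \<in> induced_rel X (collapse_rel X A) r"
  shows "(\<exists>x\<in>P. \<exists>y\<in>Q. (x, y) \<in> r) \<or>
         ((\<exists>x\<in>P. \<exists>a\<in>A. (x, a) \<in> r) \<and> (\<exists>b\<in>A. \<exists>y\<in>Q. (b, y) \<in> r))"
  using assms(3) unfolding induced_rel_def
proof (induction rule: trancl_induct)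
  case (base Q)
  then show ?case by auto
next
  case (step Q Z)
  then obtain y z where yz: "Q \<in> X // collapse_rel X A" "y \<in> Q" "z \<in> Z" "(y, z) \<in> r"
    by auto
  from assms(2) yz(1) show ?case
  proof (cases rule: quotient_collapse_rel_cases)
    case 1
    \<comment> \<open>Either alternative for \<open>(P, A)\<close> gives a comparison from
      \<open>P\<close> into \<open>A\<close>, and \<open>(y, z)\<close> leaves \<open>A\<close>: the
      second alternative holds.\<close>
    with step.IH yz show ?thesis by blast
  next
    case (2 x)
    \<comment> \<open>Here \<open>y = x\<close>, so \<open>(y, z)\<close> extends whichever
      comparison ended in \<open>Q\<close>, and the alternative is preserved.\<close>
    with step.IH yz \<open>trans r\<close> show ?thesis by (blast dest: transD)
  qed
qed

lemma irrefl_on_induced_rel_collapse: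
  assumes "strict_poset X r" "antichain_in X r A"
  shows "irrefl_on (X // collapse_rel X A) (induced_rel X (collapse_rel X A) r)"
proof (rule irrefl_onI, rule notI)
  fix P
  assume P: "P \<in> X // collapse_rel X A" "(P, P) \<in> induced_rel X (collapse_rel X A) r"
  have A: "A \<subseteq> X" "\<And>a b. a \<in> A \<Longrightarrow> b \<in> A \<Longrightarrow> (a, b) \<notin> r"
    using assms(2) by (auto simp: antichain_in_def)
  have r: "trans r" "\<And>x. x \<in> X \<Longrightarrow> (x, x) \<notin> r"
    using assms(1) by (auto simp: strict_poset_def irrefl_on_def)
  note lift = induced_rel_collapse_lift[OF r(1) A(1) P(2)]
  from A(1) P(1) show False
  proof (cases rule: quotient_collapse_rel_cases)
    case 1
    \<comment> \<open>Both alternatives exhibit a comparison inside \<open>A\<close>.\<close>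
    with lift A(2) show ?thesis by blast
  next
    case (2 x)
    \<comment> \<open>Either \<open>x < x\<close>, or \<open>b < x < a\<close> with \<open>a\<close>
      and \<open>b\<close> in \<open>A\<close>.\<close>
    with lift A(2) r show ?thesis by (blast dest: transD)
  qed
qed

lemma proj_induced_rel:
  assumes "equiv X R" "x \<in> X" "y \<in> X" "(x, y) \<in> r"
  shows "(Equiv_Relations.proj R x, Equiv_Relations.proj R y) \<in> induced_rel X R r"
proof -
  have "x \<in> R `` {x}" "y \<in> R `` {y}"
    using equiv_class_self[OF assms(1)] assms(2,3) by blast+
  then show ?thesis
    using assms unfolding induced_rel_def Equiv_Relations.proj_def
    by (blast intro: quotientI)
qed

theorem theorem15:
  fixes X A :: "'a set" and r :: "'a rel"
  assumes "strict_poset X r" and "A \<subseteq> X"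
  shows "order_preserving X r
           (X // collapse_rel X A) (induced_rel X (collapse_rel X A) r)
           (Equiv_Relations.proj (collapse_rel X A))
         \<longleftrightarrow> antichain_in X r A"
proof
  assume L: "order_preserving X r
           (X // collapse_rel X A) (induced_rel X (collapse_rel X A) r)
           (Equiv_Relations.proj (collapse_rel X A))"
  have "(a, b) \<notin> r" if ab: "a \<in> A" "b \<in> A" for a b
  proof
    assume "(a, b) \<in> r"
    moreover have X: "a \<in> X" "b \<in> X"
      using ab assms(2) by auto
    ultimately have
      "(collapse_rel X A `` {a}, collapse_rel X A `` {b}) \<in> induced_rel X (collapse_rel X A) r"
      using L by (auto simp: order_preserving_def Equiv_Relations.proj_def)
    \<comment> \<open>Both points have class \<open>A\<close>, so a comparison between them becomes
      a loop.\<close>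
    then have "(A, A) \<in> induced_rel X (collapse_rel X A) r"
      using assms(2) ab X by (simp add: collapse_rel_Image)
    \<comment> \<open>\<open>irrefl_on\<close> excludes loops only at members of the
      quotient.\<close>
    moreover from this have "A \<in> X // collapse_rel X A"
      using induced_rel_subset by blast
    ultimately show False
      using L by (auto simp: order_preserving_def strict_poset_def irrefl_on_def)
  qed
  then show "antichain_in X r A"
    using assms(2) by (auto simp: antichain_in_def)
next
  assume "antichain_in X r A"
  \<comment> \<open>Transitivity is built into the closure; the antichain condition enters through
    irreflexivity.\<close>
  then have "strict_poset (X // collapse_rel X A) (induced_rel X (collapse_rel X A) r)"
    using irrefl_on_induced_rel_collapse[OF assms(1)] induced_rel_subset
    by (simp add: strict_poset_def) (simp add: induced_rel_def)
  then show "order_preserving X r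
           (X // collapse_rel X A) (induced_rel X (collapse_rel X A) r)
           (Equiv_Relations.proj (collapse_rel X A))"
    using assms proj_induced_rel[OF equiv_collapse_rel[OF assms(2)]]
    by (auto simp: order_preserving_def intro: proj_preserves)
qed

end
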